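(* Let $K$ be an infinite field of characteristic different from $2$ and $3$, and let $(A,\omega)$ be a Bernstein algebra over $K$ whose barideal $N=\ker(\omega)$ is locally nilpotent. If $A$ is Noetherian, then $A$ is finite-dimensional over $K$.
   Context: Algebras over $K$ are not assumed associative, unital or finite-dimensional. A baric algebra over $K$ is a pair $(A,\omega)$ where $A$ is a $K$-algebra and $\omega:A\to K$ is a nonzero homomorphism of $K$-algebras; its barideal is $\ker(\omega)$. A Bernstein algebra is a commutative baric algebra $(A,\omega)$ satisfying $(x^2)^2=\omega(x)^2x^2$ for all $x\in A$. For an algebra $B$, the powers are defined by $B^1=B$ and $B^i=\sum_{r+s=i,\ r,s\ge 1}B^rB^s$ for $i\ge 2$ (products of subspaces are linear spans of products of elements); $B$ is nilpotent if $B^n=0$ for some $n$. An algebra is locally nilpotent if each of its finitely generated subalgebras is nilpotent. An algebra is Noetherian if every ascending sequence of its ideals is stationary. *)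

theory Defs
  imports Complex_Main
begin

text \<open>
  Algebras over a field: a vector space with a bilinear multiplication, which is not assumed to be
  associative, commutative or unital. The underlying vector space is the whole type \<^typ>\<open>'a\<close>.
\<close>

locale nonassoc_algebra = vector_space scale
  for scale :: "'k::field \<Rightarrow> 'a::ab_group_add \<Rightarrow> 'a" (infixr \<open>*s\<close> 75) +
  fixes mult :: "'a \<Rightarrow> 'a \<Rightarrow> 'a" (infixl \<open>\<star>\<close> 70)
  assumes mult_add_left: "(x + y) \<star> z = x \<star> z + y \<star> z"
    and mult_add_right: "x \<star> (y + z) = x \<star> y + x \<star> z"
    and mult_scale_left: "(c *s x) \<star> y = c *s (x \<star> y)"
    and mult_scale_right: "x \<star> (c *s y) = c *s (x \<star> y)"
begin

definition subalgebra :: "'a set \<Rightarrow> bool" where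
  "subalgebra B \<longleftrightarrow> subspace B \<and> (\<forall>x\<in>B. \<forall>y\<in>B. x \<star> y \<in> B)"

definition ideal :: "'a set \<Rightarrow> bool" where
  "ideal I \<longleftrightarrow> subspace I \<and> (\<forall>a. \<forall>x\<in>I. a \<star> x \<in> I \<and> x \<star> a \<in> I)"

definition subspace_mult :: "'a set \<Rightarrow> 'a set \<Rightarrow> 'a set" where
  "subspace_mult U V = span {x \<star> y |x y. x \<in> U \<and> y \<in> V}"

text \<open>
  The sum of a family of subspaces is the span of their union, and \<open>r\<close> and \<open>i - r\<close> run through the
  pairs of positive numbers with sum \<open>i\<close>. Powers start at exponent 1; the value at 0 is a dummy.
\<close>

function alg_power :: "'a set \<Rightarrow> nat \<Rightarrow> 'a set" where
  "alg_power B i =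
    (if i \<le> 1 then B
     else span (\<Union>r\<in>{1..<i}. subspace_mult (alg_power B r) (alg_power B (i - r))))"
  by auto
termination
  by (relation "measure snd") auto

declare alg_power.simps [simp del]

definition nilpotent :: "'a set \<Rightarrow> bool" where
  "nilpotent B \<longleftrightarrow> (\<exists>n\<ge>1. alg_power B n = {0})"

text \<open>
  Intended for a subalgebra \<open>B\<close>: the finitely generated subalgebras of \<open>B\<close> are then the
  sets \<^term>\<open>subalgebra hull S\<close> with \<open>S\<close> a finite subset of \<open>B\<close>.
\<close>

definition locally_nilpotent :: "'a set \<Rightarrow> bool" where
  "locally_nilpotent B \<longleftrightarrow> (\<forall>S. finite S \<and> S \<subseteq> B \<longrightarrow> nilpotent (subalgebra hull S))"

definition noetherian :: bool where
  "noetherian \<longleftrightarrow>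
    (\<forall>I :: nat \<Rightarrow> 'a set. (\<forall>n. ideal (I n)) \<and> (\<forall>n. I n \<subseteq> I (Suc n)) \<longrightarrow>
      (\<exists>n. \<forall>m\<ge>n. I m = I n))"

end

locale baric_algebra = nonassoc_algebra scale mult
  for scale :: "'k::field \<Rightarrow> 'a::ab_group_add \<Rightarrow> 'a" (infixr \<open>*s\<close> 75)
    and mult :: "'a \<Rightarrow> 'a \<Rightarrow> 'a" (infixl \<open>\<star>\<close> 70) +
  fixes \<omega> :: "'a \<Rightarrow> 'k"
  assumes weight_linear: "Vector_Spaces.linear scale (*) \<omega>"
    and weight_mult: "\<omega> (x \<star> y) = \<omega> x * \<omega> y"
    and weight_nonzero: "\<exists>x. \<omega> x \<noteq> 0"
begin

definition barideal :: "'a set" where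
  "barideal = {x. \<omega> x = 0}"

end

locale bernstein_algebra = baric_algebra scale mult \<omega>
  for scale :: "'k::field \<Rightarrow> 'a::ab_group_add \<Rightarrow> 'a" (infixr \<open>*s\<close> 75)
    and mult :: "'a \<Rightarrow> 'a \<Rightarrow> 'a" (infixl \<open>\<star>\<close> 70)
    and \<omega> :: "'a \<Rightarrow> 'k" +
  assumes mult_commute: "x \<star> y = y \<star> x"
    and bernstein: "(x \<star> x) \<star> (x \<star> x) = (\<omega> x)\<^sup>2 *s (x \<star> x)"

end

theory Submission
  imports Defs
begin

text \<open>
  Let \<open>e\<close> be an idempotent of weight 1 and let \<open>N = U + V\<close> be the Peirce decomposition of the
  barideal \<open>N\<close>, where \<open>e\<close> acts on \<open>U\<close> as 1/2 and on \<open>V\<close> as 0. Then \<open>U \<star> U \<subseteq> V\<close>, while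
  \<open>U \<star> V\<close> and \<open>V \<star> V\<close> lie in \<open>U\<close>. The ideal \<open>L\<close> of all \<open>x \<in> U\<close> with \<open>x \<star> U = 0\<close> contains
  \<open>V \<star> V\<close>, and \<open>N/L\<close> satisfies the polarized form \<open>(xy)z + (xz)y + x(yz) = 0\<close> of \<open>x\<^sup>3 = 0\<close>
  (\<open>cubic_identity_mod_L\<close>). Finite dimension is proved for \<open>N/L\<close> and for \<open>L\<close> separately.

  Write \<open>R\<^sub>x\<close> for multiplication by \<open>x\<close> on \<open>N/L\<close>. The cubic identity says
  \<open>R\<^sub>x R\<^sub>y + R\<^sub>y R\<^sub>x = - R\<^sub>x\<^sub>y\<close>, so local nilpotency passes from \<open>N\<close> to the algebra generated by
  these operators: in a long product of operators a letter is repeated, and moving the two copies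
  together shortens the product without decreasing its weight (\<open>long_words_mod_L\<close>). This gives a
  Nakayama lemma: an ideal \<open>P\<close> with \<open>L \<subseteq> P \<subseteq> N\<close> and \<open>P = P \<star> N + L\<close> is equal to \<open>L\<close>, because
  otherwise there is a maximal smaller ideal \<open>Q\<close>, and some \<open>p \<in> P - Q\<close> satisfies
  \<open>p = p r + q\<close> with \<open>r\<close> a nilpotent operator and \<open>q \<in> Q\<close> (\<open>nakayama\<close>).

  The chain condition also shows that \<open>N\<close> is spanned by a finite set \<open>F\<close> modulo \<open>N \<star> N + L\<close>.
  Hence the layers \<open>P\<^sub>0 = N\<close>, \<open>P\<^sub>k\<^sub>+\<^sub>1 = P\<^sub>k \<star> N + L\<close> are spanned, modulo the next one, by the
  left-normed words in \<open>F\<close> with \<open>k + 1\<close> letters (\<open>layer_words\<close>). Long words are 0 by local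
  nilpotency, so two consecutive layers agree, and they are \<open>L\<close> by the Nakayama lemma. Therefore
  \<open>N = span S + L\<close> with \<open>S\<close> finite.

  Finally \<open>L \<star> L = 0\<close>, so a subspace of \<open>L\<close> is an ideal as soon as it is stable under
  multiplication by \<open>S\<close>. By the chain condition \<open>L\<close> is then spanned by the words
  \<open>g s\<^sub>1 \<dots> s\<^sub>m\<close> with \<open>s\<^sub>i \<in> S\<close> and \<open>g\<close> in a finite set, and again only finitely many of them
  are nonzero.
\<close>

section \<open>Multiplication and spans\<close>

context nonassoc_algebra
begin

lemma mult_zero_left [simp]: "0 \<star> x = 0"
  using mult_add_left[of 0 0 x] by simp

lemma mult_zero_right [simp]: "x \<star> 0 = 0"
  using mult_add_right[of x 0 0] by simp

lemma mult_minus_left: "(- x) \<star> y = - (x \<star> y)"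
  using mult_add_left[of x "- x" y] by (simp add: eq_neg_iff_add_eq_0 add.commute)

lemma mult_minus_right: "x \<star> (- y) = - (x \<star> y)"
  using mult_add_right[of x y "- y"] by (simp add: eq_neg_iff_add_eq_0 add.commute)

lemma mult_diff_left: "(x - y) \<star> z = x \<star> z - y \<star> z"
  using mult_add_left[of x "- y" z] by (simp add: mult_minus_left)

lemma mult_diff_right: "x \<star> (y - z) = x \<star> y - x \<star> z"
  using mult_add_right[of x y "- z"] by (simp add: mult_minus_right)

lemma mult_span_left:
  assumes "x \<in> span S" "subspace W" "\<And>s. s \<in> S \<Longrightarrow> s \<star> y \<in> W"
  shows "x \<star> y \<in> W"
proof -
  have "subspace {x. x \<star> y \<in> W}"
    using assms(2) by (auto simp: subspace_def mult_add_left mult_scale_left)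
  with assms(1,3) show ?thesis
    using span_induct[of x S "\<lambda>x. x \<star> y \<in> W"] by blast
qed

lemma mult_span_right:
  assumes "y \<in> span S" "subspace W" "\<And>s. s \<in> S \<Longrightarrow> x \<star> s \<in> W"
  shows "x \<star> y \<in> W"
proof -
  have "subspace {y. x \<star> y \<in> W}"
    using assms(2) by (auto simp: subspace_def mult_add_right mult_scale_right)
  with assms(1,3) show ?thesis
    using span_induct[of y S "\<lambda>y. x \<star> y \<in> W"] by blast
qed

lemma foldl_mult_add: "foldl (\<star>) (x + y) zs = foldl (\<star>) x zs + foldl (\<star>) y zs"
  by (induction zs arbitrary: x y) (simp_all add: mult_add_left)

lemma foldl_mult_scale: "foldl (\<star>) (c *s x) zs = c *s foldl (\<star>) x zs"
  by (induction zs arbitrary: x) (simp_all add: mult_scale_left)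

lemma foldl_mult_zero: "foldl (\<star>) 0 zs = 0"
  by (induction zs) simp_all

lemma foldl_mult_zero_mem: "0 \<in> set zs \<Longrightarrow> foldl (\<star>) x zs = 0"
  by (induction zs arbitrary: x) (auto simp: foldl_mult_zero)

lemma foldl_mult_span:
  assumes "x \<in> span S" "subspace W" "\<And>s. s \<in> S \<Longrightarrow> foldl (\<star>) s zs \<in> W"
  shows "foldl (\<star>) x zs \<in> W"
proof -
  have "subspace {x. foldl (\<star>) x zs \<in> W}"
    using assms(2)
    by (auto simp: subspace_def foldl_mult_add foldl_mult_scale foldl_mult_zero)
  with assms(1,3) show ?thesis
    using span_induct[of x S "\<lambda>x. foldl (\<star>) x zs \<in> W"] by blast
qed

lemma foldl_mult_ideal: "ideal I \<Longrightarrow> x \<in> I \<Longrightarrow> foldl (\<star>) x zs \<in> I"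
  by (induction zs arbitrary: x) (auto simp: ideal_def)

text \<open>
  The ascending chain condition in the form in which it is used throughout: an ideal that is
  maximal in a family cannot be enlarged within it.
\<close>

lemma noetherian_maximal:
  assumes noetherian "\<C> \<noteq> {}" "\<And>I. I \<in> \<C> \<Longrightarrow> ideal I"
  shows "\<exists>M\<in>\<C>. \<forall>I\<in>\<C>. M \<subseteq> I \<longrightarrow> I = M"
proof (rule ccontr)
  assume "\<not> ?thesis"
  then have step: "\<exists>J. J \<in> \<C> \<and> I \<subset> J" if "I \<in> \<C>" for I
    using that by blast
  obtain I0 where "I0 \<in> \<C>" using assms(2) by blast
  then have "\<exists>f. \<forall>n::nat. f n \<in> \<C> \<and> f n \<subset> f (Suc n)"
    using dependent_nat_choice[of "\<lambda>_ I. I \<in> \<C>" "\<lambda>_ I J. I \<subset> J"] step by metis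
  then obtain f where f: "\<And>n::nat. f n \<in> \<C> \<and> f n \<subset> f (Suc n)" by blast
  then have "\<forall>n. ideal (f n)" "\<forall>n. f n \<subseteq> f (Suc n)" using assms(3) by blast+
  then obtain n where "\<forall>m\<ge>n. f m = f n"
    using assms(1) unfolding noetherian_def by blast
  moreover have "f n \<subset> f (Suc n)" using f by blast
  ultimately show False using le_SucI[OF le_refl] by blast
qed

section \<open>Monomials and local nilpotency\<close>

text \<open>
  Nonassociative monomials in \<open>X\<close>, indexed by their degree; one element may be a monomial in
  several degrees.
\<close>

inductive monomial :: "'a set \<Rightarrow> nat \<Rightarrow> 'a \<Rightarrow> bool" for X where
  generator: "x \<in> X \<Longrightarrow> monomial X 1 x"
| product: "monomial X i x \<Longrightarrow> monomial X j y \<Longrightarrow> monomial X (i + j) (x \<star> y)"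

lemma monomial_pos: "monomial X k x \<Longrightarrow> 1 \<le> k"
  by (induction rule: monomial.induct) auto

lemma finite_monomials:
  assumes "finite X"
  shows "finite {x. monomial X k x}"
proof (induction k rule: less_induct)
  case (less k)
  let ?M = "\<lambda>k. {x. monomial X k x}"
  have "?M k \<subseteq> X \<union> (\<Union>i\<in>{1..<k}. (\<lambda>(x, y). x \<star> y) ` (?M i \<times> ?M (k - i)))"
  proof
    fix x assume "x \<in> ?M k"
    then have "monomial X k x" by simp
    then show "x \<in> X \<union> (\<Union>i\<in>{1..<k}. (\<lambda>(x, y). x \<star> y) ` (?M i \<times> ?M (k - i)))"
    proof cases
      case (product i y j z)
      then have "i \<in> {1..<k}" "k - i = j"
        using monomial_pos[of X i y] monomial_pos[of X j z] by auto
      with product show ?thesis by force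
    qed auto
  qed
  moreover have "finite (X \<union> (\<Union>i\<in>{1..<k}. (\<lambda>(x, y). x \<star> y) ` (?M i \<times> ?M (k - i))))"
    using assms less.IH by auto
  ultimately show ?case by (rule finite_subset)
qed

lemma monomial_foldl:
  assumes "monomial X k x" "set ys \<subseteq> X"
  shows "monomial X (k + length ys) (foldl (\<star>) x ys)"
  using assms
proof (induction ys arbitrary: k x)
  case (Cons y ys)
  then have "monomial X (k + 1) (x \<star> y)"
    by (intro monomial.product monomial.generator) auto
  from Cons.IH[OF this] Cons.prems show ?case by simp
qed simp

lemma alg_power_1: "alg_power B 1 = B"
  by (simp add: alg_power.simps)

lemma mult_mem_alg_power:
  assumes "x \<in> alg_power B i" "y \<in> alg_power B j" "1 \<le> i" "1 \<le> j"
  shows "x \<star> y \<in> alg_power B (i + j)"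
proof -
  have "x \<star> y \<in> subspace_mult (alg_power B i) (alg_power B (i + j - i))"
    unfolding subspace_mult_def using assms by (intro span_base) auto
  moreover have "i \<in> {1..<i + j}" using assms by auto
  ultimately have
    "x \<star> y \<in> (\<Union>r\<in>{1..<i + j}. subspace_mult (alg_power B r) (alg_power B (i + j - r)))"
    by blast
  then have
    "x \<star> y \<in> span (\<Union>r\<in>{1..<i + j}. subspace_mult (alg_power B r) (alg_power B (i + j - r)))"
    by (rule span_base)
  then show ?thesis
    using assms(3,4) by (subst alg_power.simps) auto
qed

lemma subspace_alg_power: "subspace B \<Longrightarrow> subspace (alg_power B i)"
  by (subst alg_power.simps) auto

lemma alg_power_Suc_subset:
  assumes "subalgebra B" "1 \<le> i"
  shows "alg_power B (Suc i) \<subseteq> alg_power B i"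
  using assms(2)
proof (induction i rule: less_induct)
  case (less i)
  have sub: "subspace (alg_power B i)"
    using assms(1) by (intro subspace_alg_power) (simp add: subalgebra_def)
  have "x \<star> y \<in> alg_power B i"
    if r: "r \<in> {1..<Suc i}" and x: "x \<in> alg_power B r" and y: "y \<in> alg_power B (Suc i - r)"
    for r x y
  proof (cases "r = 1")
    case False
    then have "alg_power B r \<subseteq> alg_power B (r - 1)"
      using less.IH[of "r - 1"] r by (cases r) auto
    then have "x \<in> alg_power B (r - 1)" using x by blast
    then have "x \<star> y \<in> alg_power B ((r - 1) + (Suc i - r))"
      using y r False by (intro mult_mem_alg_power) auto
    also have "(r - 1) + (Suc i - r) = i" using r by auto
    finally show ?thesis .
  next
    case True
    show ?thesis
    proof (cases "i = 1")
      case True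
      then have "x \<in> B" "y \<in> B" using x y \<open>r = 1\<close> by (auto simp: alg_power_1[simplified])
      then show ?thesis
        using assms(1) True by (simp add: alg_power_1[simplified] subalgebra_def)
    next
      case False
      then have "alg_power B i \<subseteq> alg_power B (i - 1)"
        using less.IH[of "i - 1"] less.prems by auto
      then have "y \<in> alg_power B (i - 1)" using y \<open>r = 1\<close> by auto
      then have "x \<star> y \<in> alg_power B (r + (i - 1))"
        using x r False \<open>r = 1\<close> by (intro mult_mem_alg_power) auto
      also have "r + (i - 1) = i" using r \<open>r = 1\<close> by auto
      finally show ?thesis .
    qed
  qed
  then have "(\<Union>r\<in>{1..<Suc i}. subspace_mult (alg_power B r) (alg_power B (Suc i - r)))
      \<subseteq> alg_power B i"
    unfolding subspace_mult_def using sub by (intro UN_least span_minimal) auto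
  then show ?case
    using less.prems sub span_minimal by (subst alg_power.simps) auto
qed

lemma alg_power_antimono:
  assumes "subalgebra B" "1 \<le> i" "i \<le> j"
  shows "alg_power B j \<subseteq> alg_power B i"
  using assms(3)
proof (induction j rule: dec_induct)
  case (step j)
  then show ?case using alg_power_Suc_subset[OF assms(1), of j] assms(2) by auto
qed simp

lemma subalgebra_hull: "subalgebra (subalgebra hull S)"
  by (rule hull_in) (fastforce simp: subalgebra_def intro!: subspace_Inter)

lemma monomial_mem_alg_power:
  "monomial X k x \<Longrightarrow> x \<in> alg_power (subalgebra hull X) k"
proof (induction rule: monomial.induct)
  case (generator x)
  then show ?case using hull_subset[of X subalgebra] by (auto simp: alg_power_1[simplified])
next
  case (product i x j y)
  then show ?case by (intro mult_mem_alg_power monomial_pos) auto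
qed

text \<open>
  This is the only form in which local nilpotency enters below. It covers all large degrees, and
  not just one, because the powers of a subalgebra decrease.
\<close>

lemma locally_nilpotent_monomials_vanish:
  assumes "locally_nilpotent B" "finite X" "X \<subseteq> B"
  obtains n where "\<And>k x. monomial X k x \<Longrightarrow> n \<le> k \<Longrightarrow> x = 0"
proof -
  from assms obtain n where n: "n \<ge> 1" "alg_power (subalgebra hull X) n = {0}"
    unfolding locally_nilpotent_def nilpotent_def by blast
  show thesis
  proof (rule that[of n])
    fix k x assume "monomial X k x" "n \<le> k"
    then have "x \<in> alg_power (subalgebra hull X) n"
      using monomial_mem_alg_power alg_power_antimono[OF subalgebra_hull n(1)] by blast
    with n(2) show "x = 0" by simp
  qed
qed

end

section \<open>The Peirce decomposition of a Bernstein algebra\<close>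

locale bernstein_idempotent = bernstein_algebra scale mult \<omega>
  for scale :: "'k::field \<Rightarrow> 'a::ab_group_add \<Rightarrow> 'a" (infixr \<open>*s\<close> 75)
    and mult :: "'a \<Rightarrow> 'a \<Rightarrow> 'a" (infixl \<open>\<star>\<close> 70)
    and \<omega> :: "'a \<Rightarrow> 'k" +
  fixes e :: 'a
  assumes idem: "e \<star> e = e"
    and weight_e: "\<omega> e = 1"
    and two_nonzero: "(2::'k) \<noteq> 0"
    and three_nonzero: "(3::'k) \<noteq> 0"
begin

lemma weight_add: "\<omega> (x + y) = \<omega> x + \<omega> y"
proof -
  interpret w: Vector_Spaces.linear scale "(*)" \<omega> by (rule weight_linear)
  show ?thesis by (rule w.add)
qed

lemma weight_scale: "\<omega> (c *s x) = c * \<omega> x"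
proof -
  interpret w: Vector_Spaces.linear scale "(*)" \<omega> by (rule weight_linear)
  show ?thesis by (rule w.scale)
qed

lemma weight_minus: "\<omega> (- x) = - \<omega> x"
  using weight_scale[of "- 1" x] by simp

lemma subspace_barideal: "subspace barideal"
  using weight_scale[of 0 0] by (auto simp: subspace_def barideal_def weight_add weight_scale)

lemma ideal_barideal: "ideal barideal"
  using subspace_barideal by (auto simp: ideal_def barideal_def weight_mult)

lemma double_eq_scale: "x + x = (2::'k) *s x"
proof -
  have "(2::'k) *s x = (1 + 1) *s x" by simp
  also have "\<dots> = x + x" by (simp only: scale_left_distrib scale_one)
  finally show ?thesis by simp
qed

lemma double_eq_0:
  assumes "(x::'a) + x = 0"
  shows "x = 0"
proof -
  have "(2::'k) *s x = 0" using assms double_eq_scale[of x] by (simp only:)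
  with two_nonzero show ?thesis by simp
qed

lemma half_double: "inverse 2 *s (x + x) = x"
  using two_nonzero by (simp add: double_eq_scale)

lemma double_mem:
  assumes "subspace W" "x + x \<in> W"
  shows "x \<in> W"
  using subspace_scale[OF assms, of "inverse 2"] by (simp only: half_double)

text \<open>
  The Bernstein identity at \<open>e + n\<close>, \<open>e - n\<close> and \<open>e + 2 *s n\<close> separates the parts of degree 1, 2
  and 3 in \<open>n\<close>, because 2 and 3 are invertible; the part of degree 4 is the Bernstein identity
  for \<open>n\<close> itself.
\<close>

lemma barideal_identities:
  assumes "n \<in> barideal"
  shows square_square: "(n \<star> n) \<star> (n \<star> n) = 0"
    and peirce_linear: "e \<star> (e \<star> n) + e \<star> (e \<star> n) = e \<star> n"
    and peirce_square: "(e \<star> n) \<star> (e \<star> n) + (e \<star> n) \<star> (e \<star> n)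
        + (e \<star> n) \<star> (e \<star> n) + (e \<star> n) \<star> (e \<star> n) + e \<star> (n \<star> n) + e \<star> (n \<star> n) = n \<star> n"
    and peirce_cube: "(e \<star> n) \<star> (n \<star> n) = 0"
proof -
  define D where "D m = e \<star> (e \<star> m) + e \<star> (e \<star> m) - e \<star> m" for m
  define S where "S m = (e \<star> m) \<star> (e \<star> m) + (e \<star> m) \<star> (e \<star> m) + (e \<star> m) \<star> (e \<star> m)
    + (e \<star> m) \<star> (e \<star> m) + e \<star> (m \<star> m) + e \<star> (m \<star> m) - m \<star> m" for m
  define C where "C m = (e \<star> m) \<star> (m \<star> m)" for m
  have square: "(m \<star> m) \<star> (m \<star> m) = 0" if "\<omega> m = 0" for m
    using bernstein[of m] that by simp
  have sum: "D m + D m + S m + C m + C m + C m + C m = 0" if w: "\<omega> m = 0" for m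
  proof -
    define a where "a = e \<star> m"
    define b where "b = m \<star> m"
    have bb: "b \<star> b = 0" using square[OF w] by (simp add: b_def)
    have comm: "m \<star> e = e \<star> m" "b \<star> e = e \<star> b" "b \<star> a = a \<star> b" "a \<star> e = e \<star> a"
      using mult_commute by blast+
    have "(e + m) \<star> (e + m) = e + a + a + b"
      by (simp add: mult_add_left mult_add_right idem comm a_def b_def algebra_simps)
    then have "(e + a + a + b) \<star> (e + a + a + b) = e + a + a + b"
      using bernstein[of "e + m"] by (simp add: weight_add weight_e w)
    then show ?thesis
      unfolding D_def S_def C_def a_def[symmetric] b_def[symmetric]
      by (simp add: mult_add_left mult_add_right idem comm bb algebra_simps)
  qed
  have D_scale: "D (c *s m) = c *s D m" for c m
    by (simp add: D_def mult_scale_right scale_right_distrib scale_right_diff_distrib)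
  have S_scale: "S (c *s m) = (c * c) *s S m" for c m
    by (simp add: S_def mult_scale_right mult_scale_left scale_right_distrib
        scale_right_diff_distrib)
  have C_scale: "C (c *s m) = (c * c * c) *s C m" for c m
    by (simp add: C_def mult_scale_right mult_scale_left mult.assoc)
  have w: "\<omega> n = 0" using assms by (simp add: barideal_def)
  have scaled: "(c * 2) *s D n + (c * c) *s S n + (c * c * c * 4) *s C n = 0" for c
  proof -
    have "c *s (D n + D n) + (c * c) *s S n + (c * c * c) *s (C n + C n + C n + C n) = 0"
      using sum[of "c *s n"] w
      by (simp add: weight_scale D_scale S_scale C_scale scale_right_distrib add.assoc)
    moreover have "D n + D n = 2 *s D n"
      by (rule double_eq_scale)
    moreover have "C n + C n + C n + C n = 4 *s C n"
    proof -
      have "(4::'k) = 1 + 1 + 1 + 1" by simp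
      then show ?thesis by (simp only: scale_left_distrib scale_one)
    qed
    ultimately show ?thesis by simp
  qed
  have plus: "2 *s D n + S n + 4 *s C n = 0" using scaled[of 1] by simp
  have minus: "S n = 2 *s D n + 4 *s C n"
    using scaled[of "-1"] by (simp add: add_eq_0_iff algebra_simps)
  have "S n + S n = 0" using plus minus by (simp add: algebra_simps)
  then have S0: "S n = 0" by (rule double_eq_0)
  have D0: "2 *s D n = - (4 *s C n)" using plus S0 by (simp add: eq_neg_iff_add_eq_0)
  have "4 *s D n = 2 *s (2 *s D n)" by simp
  also have "\<dots> = - (8 *s C n)" by (simp only: D0) simp
  finally have "4 *s D n = - (8 *s C n)" .
  then have "32 *s C n - 8 *s C n = 0"
    using scaled[of 2] S0 by (simp add: algebra_simps)
  then have "24 *s C n = 0" by (simp flip: scale_left_diff_distrib)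
  moreover have "(24::'k) = 2 * (2 * (2 * 3))" by simp
  then have "(24::'k) \<noteq> 0" using two_nonzero three_nonzero by (metis no_zero_divisors)
  ultimately have C0: "C n = 0" by simp
  have D1: "D n = 0" using D0 C0 two_nonzero by simp
  show "(n \<star> n) \<star> (n \<star> n) = 0" using square[OF w] .
  show "e \<star> (e \<star> n) + e \<star> (e \<star> n) = e \<star> n"
    using D1 unfolding D_def by (simp only: right_minus_eq)
  show "(e \<star> n) \<star> (e \<star> n) + (e \<star> n) \<star> (e \<star> n) + (e \<star> n) \<star> (e \<star> n)
      + (e \<star> n) \<star> (e \<star> n) + e \<star> (n \<star> n) + e \<star> (n \<star> n) = n \<star> n"
    using S0 unfolding S_def by (simp only: right_minus_eq)
  show "(e \<star> n) \<star> (n \<star> n) = 0"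
    using C0 unfolding C_def .
qed

text \<open>
  The bilinear identity that decides the Peirce component of a product; it also shows how \<open>e\<close>
  acts on \<open>x \<star> y\<close> when \<open>x\<close> and \<open>y\<close> are not homogeneous.
\<close>

lemma peirce_mult:
  assumes "x \<in> barideal" "y \<in> barideal"
  shows "(e \<star> x) \<star> (e \<star> y) + (e \<star> x) \<star> (e \<star> y) + (e \<star> x) \<star> (e \<star> y)
    + (e \<star> x) \<star> (e \<star> y) + e \<star> (x \<star> y) + e \<star> (x \<star> y) = x \<star> y"
proof -
  define F where "F m n = (e \<star> m) \<star> (e \<star> n) + (e \<star> m) \<star> (e \<star> n) + (e \<star> m) \<star> (e \<star> n)
    + (e \<star> m) \<star> (e \<star> n) + e \<star> (m \<star> n) + e \<star> (m \<star> n) - m \<star> n" for m n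
  have "x + y \<in> barideal" using assms subspace_barideal by (intro subspace_add)
  then have "F (x + y) (x + y) = 0" "F x x = 0" "F y y = 0"
    using assms peirce_square by (simp_all add: F_def)
  moreover have "F (x + y) (x + y) = F x x + F x y + F y x + F y y"
    by (simp add: F_def mult_add_left mult_add_right)
  moreover have "F y x = F x y"
    unfolding F_def by (simp only: mult_commute[of y x] mult_commute[of "e \<star> y" "e \<star> x"])
  ultimately have "F x y + F x y = 0" by simp
  then have "F x y = 0" by (rule double_eq_0)
  then show ?thesis unfolding F_def by (simp only: right_minus_eq)
qed

definition U :: "'a set" where
  "U = {x \<in> barideal. e \<star> x + e \<star> x = x}"

definition V :: "'a set" where
  "V = {x \<in> barideal. e \<star> x = 0}"

lemma subspace_U: "subspace U"
  using subspace_barideal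
  by (auto simp: subspace_def U_def mult_add_right mult_scale_right algebra_simps
      simp flip: scale_right_distrib)

lemma subspace_V: "subspace V"
  using subspace_barideal
  by (auto simp: subspace_def V_def mult_add_right mult_scale_right)

lemma U_barideal: "x \<in> U \<Longrightarrow> x \<in> barideal" and V_barideal: "x \<in> V \<Longrightarrow> x \<in> barideal"
  by (simp_all add: U_def V_def)

lemma e_mult_U: "x \<in> U \<Longrightarrow> e \<star> x = inverse 2 *s x"
  using half_double[of "e \<star> x"] by (simp add: U_def)

lemma e_mult_V: "x \<in> V \<Longrightarrow> e \<star> x = 0"
  by (simp add: V_def)

lemma U_inter_V: "x \<in> U \<Longrightarrow> x \<in> V \<Longrightarrow> x = 0"
  by (auto simp: U_def V_def)

lemma mult_barideal: "x \<in> barideal \<Longrightarrow> y \<in> barideal \<Longrightarrow> x \<star> y \<in> barideal"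
  by (simp add: barideal_def weight_mult)

lemma peirce_decomposition:
  assumes "x \<in> barideal"
  obtains v where "e \<star> x + e \<star> x \<in> U" "v \<in> V" "x = (e \<star> x + e \<star> x) + v"
proof
  define a where "a = e \<star> x"
  have a: "e \<star> a + e \<star> a = a" unfolding a_def using peirce_linear[OF assms] .
  have "\<omega> a = 0" using assms by (simp add: a_def barideal_def weight_mult)
  then show "e \<star> x + e \<star> x \<in> U"
    using a unfolding a_def[symmetric]
    by (simp add: U_def barideal_def weight_add mult_add_right)
  have "\<omega> (x - (a + a)) = 0"
    using assms \<open>\<omega> a = 0\<close> weight_add[of "x - (a + a)" "a + a"]
    by (simp add: barideal_def weight_add)
  moreover have "e \<star> (x - (a + a)) = 0"
    using a mult_add_right[of e "x - (a + a)" "a + a"]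
    by (simp add: mult_add_right flip: a_def)
  ultimately show "x - (e \<star> x + e \<star> x) \<in> V"
    by (simp add: V_def barideal_def flip: a_def)
  show "x = (e \<star> x + e \<star> x) + (x - (e \<star> x + e \<star> x))" by simp
qed

lemma UU_V:
  assumes "x \<in> U" "y \<in> U"
  shows "x \<star> y \<in> V"
proof -
  define a b where "a = e \<star> x" and "b = e \<star> y"
  have "a + a = x" "b + b = y" using assms by (auto simp: U_def a_def b_def)
  then have "x \<star> y = a \<star> b + a \<star> b + a \<star> b + a \<star> b"
    by (auto simp: mult_add_left mult_add_right add.assoc)
  moreover have "a \<star> b + a \<star> b + a \<star> b + a \<star> b + e \<star> (x \<star> y) + e \<star> (x \<star> y) = x \<star> y"
    unfolding a_def b_def using assms by (intro peirce_mult U_barideal)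
  ultimately have "e \<star> (x \<star> y) + e \<star> (x \<star> y) = 0"
    by (simp add: add.assoc)
  then have "e \<star> (x \<star> y) = 0" by (rule double_eq_0)
  then show ?thesis
    using assms by (simp add: V_def mult_barideal U_barideal)
qed

lemma UV_U: "x \<in> U \<Longrightarrow> y \<in> V \<Longrightarrow> x \<star> y \<in> U"
  using peirce_mult[of x y] by (simp add: U_def V_def mult_barideal)

lemma VU_U: "x \<in> V \<Longrightarrow> y \<in> U \<Longrightarrow> x \<star> y \<in> U"
  using UV_U[of y x] by (simp add: mult_commute)

lemma VV_U: "x \<in> V \<Longrightarrow> y \<in> V \<Longrightarrow> x \<star> y \<in> U"
  using peirce_mult[of x y] by (simp add: U_def V_def mult_barideal)

text \<open>
  For \<open>u + v\<close> the identity \<open>(e \<star> n) \<star> (n \<star> n) = 0\<close> only involves \<open>u\<close> in its first factor. The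
  three parts of degree 0, 1 and 2 in \<open>v\<close> are separated by the substitutions \<open>0\<close>, \<open>v\<close> and \<open>- v\<close>.
\<close>

lemma U_cube_and_absorption:
  assumes u: "u \<in> U" and v: "v \<in> V"
  shows U_cube: "u \<star> (u \<star> u) = 0"
    and U_absorb: "u \<star> (u \<star> v) = 0"
    and U_square: "u \<star> (v \<star> v) = 0"
proof -
  have key: "u \<star> ((u + w) \<star> (u + w)) = 0" if w: "w \<in> V" for w
  proof -
    have "u + w \<in> barideal"
      using u w subspace_barideal by (intro subspace_add U_barideal V_barideal)
    from peirce_cube[OF this] have *: "(e \<star> u) \<star> ((u + w) \<star> (u + w)) = 0"
      using w by (simp add: mult_add_right[of e] e_mult_V)
    have "u \<star> ((u + w) \<star> (u + w)) = (e \<star> u + e \<star> u) \<star> ((u + w) \<star> (u + w))"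
      using u by (simp add: U_def)
    with * show ?thesis by (simp only: mult_add_left[of "e \<star> u" "e \<star> u"]) simp
  qed
  define p q where "p = u \<star> (u \<star> v)" and "q = u \<star> (v \<star> v)"
  have vu: "v \<star> u = u \<star> v" by (rule mult_commute)
  show c: "u \<star> (u \<star> u) = 0" using key[of 0] subspace_V by (simp add: subspace_0)
  have plus: "p + p + q = 0"
    using key[OF v] c by (simp add: p_def q_def mult_add_left mult_add_right vu add.assoc)
  have "- v \<in> V" using v subspace_V by (intro subspace_neg)
  then have minus: "- p + - p + q = 0"
    using key[of "- v"] c
    by (simp add: p_def q_def mult_add_left mult_add_right mult_minus_left mult_minus_right
        mult_diff_left mult_diff_right
        mult_diff_left mult_diff_right vu algebra_simps)
  have "q + q = (p + p + q) + (- p + - p + q)" by (simp add: algebra_simps)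
  then have "q = 0" using plus minus by (rule_tac double_eq_0) simp
  then have "p = 0" using plus by (rule_tac double_eq_0) simp
  show "u \<star> (u \<star> v) = 0" using \<open>p = 0\<close> by (simp add: p_def)
  show "u \<star> (v \<star> v) = 0" using \<open>q = 0\<close> by (simp add: q_def)
qed

lemma U_cube_polarized:
  assumes "x \<in> U" "y \<in> U" "z \<in> U"
  shows "x \<star> (y \<star> z) + y \<star> (x \<star> z) + z \<star> (x \<star> y) = 0"
proof -
  have zero: "(0::'a) \<in> V" using subspace_V by (rule subspace_0)
  \<comment> \<open>\<open>F a b\<close> is the part of \<open>(a + b) \<star> ((a + b) \<star> (a + b))\<close> that is linear in \<open>b\<close>.\<close>
  define F where "F a b = a \<star> (a \<star> b) + a \<star> (a \<star> b) + b \<star> (a \<star> a)" for a b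
  have F: "F b a = 0" if "a \<in> U" "b \<in> U" for a b
  proof -
    have "a + b \<in> U" "a + - b \<in> U"
      using that subspace_add[OF subspace_U] subspace_neg[OF subspace_U] by blast+
    then have "(a + b) \<star> ((a + b) \<star> (a + b)) = 0" "(a + - b) \<star> ((a + - b) \<star> (a + - b)) = 0"
      and cubes: "a \<star> (a \<star> a) = 0" "b \<star> (b \<star> b) = 0"
      using U_cube zero that by blast+
    moreover have ba: "b \<star> a = a \<star> b" by (rule mult_commute)
    have "(a + b) \<star> ((a + b) \<star> (a + b)) = F a b + F b a"
      by (simp add: F_def mult_add_left mult_add_right ba cubes algebra_simps)
    moreover have "(a + - b) \<star> ((a + - b) \<star> (a + - b)) = - F a b + F b a"
      by (simp add: F_def mult_add_left mult_add_right mult_minus_left mult_minus_right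
          mult_diff_left mult_diff_right ba cubes algebra_simps)
    ultimately have "F a b + F b a = 0" "- F a b + F b a = 0" by simp_all
    then have "F b a + F b a = 0" by (simp add: add_eq_0_iff)
    then show ?thesis by (rule double_eq_0)
  qed
  have "x + y \<in> U" using assms subspace_U by (intro subspace_add)
  then have "F (x + y) z = 0" "F x z = 0" "F y z = 0" using F assms by blast+
  moreover have "y \<star> x = x \<star> y" by (rule mult_commute)
  then have "F (x + y) z = F x z + F y z
      + ((x \<star> (y \<star> z) + y \<star> (x \<star> z) + z \<star> (x \<star> y))
        + (x \<star> (y \<star> z) + y \<star> (x \<star> z) + z \<star> (x \<star> y)))"
    by (simp add: F_def mult_add_left mult_add_right algebra_simps)
  ultimately show ?thesis by (rule_tac double_eq_0) simp
qed

lemma U_absorb_polarized: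
  assumes "x \<in> U" "y \<in> U" "v \<in> V"
  shows "x \<star> (y \<star> v) = - (y \<star> (x \<star> v))"
proof -
  have "x + y \<in> U" using assms subspace_U by (intro subspace_add)
  then have "(x + y) \<star> ((x + y) \<star> v) = 0" "x \<star> (x \<star> v) = 0" "y \<star> (y \<star> v) = 0"
    using U_absorb assms by blast+
  then show ?thesis
    by (simp add: mult_add_left mult_add_right eq_neg_iff_add_eq_0 add.commute)
qed

lemma U_mult_VV:
  assumes "x \<in> U" "v \<in> V" "w \<in> V"
  shows "x \<star> (v \<star> w) = 0"
proof -
  have "v + w \<in> V" using assms subspace_V by (intro subspace_add)
  then have "x \<star> ((v + w) \<star> (v + w)) = 0" "x \<star> (v \<star> v) = 0" "x \<star> (w \<star> w) = 0"
    using U_square assms by blast+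
  then have "x \<star> (v \<star> w) + x \<star> (v \<star> w) = 0"
    using mult_commute[of w v] by (simp add: mult_add_left mult_add_right)
  then show ?thesis by (rule double_eq_0)
qed

text \<open>
  In the Bernstein identity for \<open>u + v\<close> and \<open>u - v\<close>, the part of degree 2 in \<open>u\<close> and in \<open>v\<close>
  has a component in \<open>U\<close> and a component in \<open>V\<close>, which vanish separately.
\<close>

lemma UV_square:
  assumes u: "u \<in> U" and v: "v \<in> V"
  shows "(u \<star> v) \<star> (u \<star> v) = 0"
proof -
  define a b c where "a = u \<star> u" and "b = v \<star> v" and "c = u \<star> v"
  have vu: "v \<star> u = c" unfolding c_def by (rule mult_commute)
  have comm: "b \<star> a = a \<star> b" "c \<star> a = a \<star> c" "c \<star> b = b \<star> c" using mult_commute by blast+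
  have mem: "u + v \<in> barideal" "u + - v \<in> barideal"
    using U_barideal[OF u] V_barideal[OF v] subspace_add[OF subspace_barideal]
      subspace_neg[OF subspace_barideal] by blast+
  have aa: "a \<star> a = 0" "b \<star> b = 0"
    using square_square u v U_barideal V_barideal by (auto simp: a_def b_def)
  have "(u + v) \<star> (u + v) = a + b + c + c"
    by (simp add: mult_add_left mult_add_right vu algebra_simps flip: a_def b_def c_def)
  then have plus: "(a + b + c + c) \<star> (a + b + c + c) = 0"
    using square_square[OF mem(1)] by simp
  have "(u + - v) \<star> (u + - v) = a + b + - c + - c"
    by (simp add: mult_add_left mult_add_right mult_minus_left mult_minus_right
        mult_diff_left mult_diff_right vu algebra_simps
        flip: a_def b_def c_def)
  then have minus: "(a + b + - c + - c) \<star> (a + b + - c + - c) = 0"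
    using square_square[OF mem(2)] by simp
  have "(a + b + c + c) \<star> (a + b + c + c) + (a + b + - c + - c) \<star> (a + b + - c + - c)
      = (a \<star> b + c \<star> c + c \<star> c + (a \<star> b + c \<star> c + c \<star> c))
        + (a \<star> b + c \<star> c + c \<star> c + (a \<star> b + c \<star> c + c \<star> c))"
    by (simp add: mult_add_left mult_add_right mult_minus_left mult_minus_right
        mult_diff_left mult_diff_right comm aa
        algebra_simps)
  then have "(a \<star> b + c \<star> c + c \<star> c + (a \<star> b + c \<star> c + c \<star> c))
        + (a \<star> b + c \<star> c + c \<star> c + (a \<star> b + c \<star> c + c \<star> c)) = 0"
    using plus minus by simp
  then have "a \<star> b + c \<star> c + c \<star> c = 0" by (rule double_eq_0[OF double_eq_0])
  then have eq: "a \<star> b = - (c \<star> c + c \<star> c)" by (simp only: eq_neg_iff_add_eq_0 add.assoc)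
  have "c \<star> c \<in> V" using u v by (auto simp: c_def intro!: UU_V UV_U)
  then have "a \<star> b \<in> V" unfolding eq using subspace_V by (intro subspace_neg subspace_add)
  moreover have "a \<star> b \<in> U"
    using VU_U[OF UU_V[OF u u] VV_U[OF v v]] by (simp add: a_def b_def)
  ultimately have "a \<star> b = 0" using U_inter_V by blast
  with eq have "c \<star> c + c \<star> c = 0" by (metis neg_equal_0_iff_equal)
  then show ?thesis unfolding c_def by (rule double_eq_0)
qed

lemma UV_square_polarized:
  assumes "x \<in> U" "y \<in> U" "v \<in> V"
  shows "(x \<star> v) \<star> (y \<star> v) = 0"
proof -
  have "x + y \<in> U" using assms subspace_U by (intro subspace_add)
  then have "((x + y) \<star> v) \<star> ((x + y) \<star> v) = 0" "(x \<star> v) \<star> (x \<star> v) = 0"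
    "(y \<star> v) \<star> (y \<star> v) = 0"
    using UV_square assms by blast+
  then have "(x \<star> v) \<star> (y \<star> v) + (x \<star> v) \<star> (y \<star> v) = 0"
    using mult_commute[of "y \<star> v" "x \<star> v"] by (simp add: mult_add_left mult_add_right)
  then show ?thesis by (rule double_eq_0)
qed

section \<open>Ideals and Peirce components\<close>

lemma homogeneous_barideal: "x \<in> U \<union> V \<Longrightarrow> x \<in> barideal"
  using U_barideal V_barideal by blast

lemma homogeneous_mult: "x \<in> U \<union> V \<Longrightarrow> y \<in> U \<union> V \<Longrightarrow> x \<star> y \<in> U \<union> V"
  using UU_V UV_U VU_U VV_U by blast

lemma homogeneous_foldl:
  "x \<in> U \<union> V \<Longrightarrow> set ys \<subseteq> U \<union> V \<Longrightarrow> foldl (\<star>) x ys \<in> U \<union> V"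
proof (induction ys arbitrary: x)
  case (Cons y ys)
  then have "x \<star> y \<in> U \<union> V" by (intro homogeneous_mult) auto
  with Cons show ?case by simp
qed simp

lemma foldl_barideal:
  "x \<in> barideal \<Longrightarrow> foldl (\<star>) x ys \<in> barideal"
  using foldl_mult_ideal[OF ideal_barideal] .

lemma e_mult_homogeneous:
  assumes "x \<in> U \<union> V" "subspace W" "x \<in> W"
  shows "e \<star> x \<in> W"
  using assms by (auto simp: e_mult_U e_mult_V subspace_0 subspace_scale)

lemma mult_barideal_mem:
  assumes "y \<in> barideal" "subspace W" "\<And>z. z \<in> U \<union> V \<Longrightarrow> x \<star> z \<in> W"
  shows "x \<star> y \<in> W"
proof -
  obtain v where "e \<star> y + e \<star> y \<in> U" "v \<in> V" and y: "y = (e \<star> y + e \<star> y) + v"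
    using peirce_decomposition[OF assms(1)] .
  then have "x \<star> (e \<star> y + e \<star> y) + x \<star> v \<in> W"
    using assms(2,3) by (intro subspace_add) auto
  then have "x \<star> ((e \<star> y + e \<star> y) + v) \<in> W" by (simp only: mult_add_right)
  with y show ?thesis by simp
qed

text \<open>
  An ideal inside the barideal is the sum of its Peirce components, because \<open>2e\<close> acts on the
  barideal as the projection to \<open>U\<close>. So an inclusion needs checking on homogeneous elements only.
\<close>

lemma ideal_component:
  assumes "ideal I" "I \<subseteq> barideal" "subspace W" "I \<inter> (U \<union> V) \<subseteq> W"
  shows "I \<subseteq> W"
proof
  fix x assume x: "x \<in> I"
  obtain v where v: "e \<star> x + e \<star> x \<in> U" "v \<in> V" "x = (e \<star> x + e \<star> x) + v"
    using peirce_decomposition assms(2) x by blast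
  have "subspace I" using assms(1) by (simp add: ideal_def)
  moreover have "e \<star> x \<in> I" using assms(1) x by (simp add: ideal_def)
  ultimately have u: "e \<star> x + e \<star> x \<in> I" by (intro subspace_add)
  have "v = x - (e \<star> x + e \<star> x)" using v(3) by (simp add: algebra_simps)
  then have "v \<in> I" using u x subspace_diff[OF \<open>subspace I\<close>] by metis
  with u v assms(4) have "e \<star> x + e \<star> x \<in> W" "v \<in> W" by auto
  then have "(e \<star> x + e \<star> x) + v \<in> W" by (rule subspace_add[OF assms(3)])
  with v(3) show "x \<in> W" by simp
qed

lemma ideal_span:
  assumes "\<And>g. g \<in> G \<Longrightarrow> e \<star> g \<in> span G"
    and "\<And>g y. g \<in> G \<Longrightarrow> y \<in> U \<union> V \<Longrightarrow> g \<star> y \<in> span G"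
  shows "ideal (span G)"
proof -
  have "x \<star> a \<in> span G" if x: "x \<in> span G" for x a
  proof -
    define n where "n = a - \<omega> a *s e"
    have "\<omega> n = 0"
      using weight_add[of n "\<omega> a *s e"] by (simp add: n_def weight_scale weight_e)
    then have n: "n \<in> barideal" by (simp add: barideal_def)
    have "x \<star> e \<in> span G"
      using x assms(1) by (intro mult_span_left[of x G]) (auto simp: mult_commute[of _ e])
    moreover have "x \<star> n \<in> span G"
    proof (rule mult_barideal_mem[OF n subspace_span])
      fix z assume "z \<in> U \<union> V"
      then show "x \<star> z \<in> span G"
        using x assms(2) by (intro mult_span_left[of x G]) auto
    qed
    ultimately have "x \<star> (\<omega> a *s e + n) \<in> span G"
      by (simp add: mult_add_right mult_scale_right span_add span_scale)
    then show ?thesis by (simp add: n_def)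
  qed
  moreover from this have "a \<star> x \<in> span G" if "x \<in> span G" for x a
    using that mult_commute[of a x] by simp
  ultimately show ?thesis by (simp add: ideal_def)
qed

section \<open>The annihilator of U in U\<close>

text \<open>
  The barideal is not nil of index 3 in general: \<open>V \<star> V\<close> may be nonzero, and so may
  \<open>(u \<star> v) \<star> v\<close>. Both obstructions annihilate \<open>U\<close>.
\<close>

definition L :: "'a set" where
  "L = {x \<in> U. \<forall>u\<in>U. x \<star> u = 0}"

lemma subspace_L: "subspace L"
  using subspace_U by (auto simp: subspace_def L_def mult_add_left mult_scale_left)

lemma L_U: "x \<in> L \<Longrightarrow> x \<in> U"
  by (simp add: L_def)

lemma L_mult_U: "x \<in> L \<Longrightarrow> y \<in> U \<Longrightarrow> x \<star> y = 0"
  by (simp add: L_def)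

lemma VV_L: "x \<in> V \<Longrightarrow> y \<in> V \<Longrightarrow> x \<star> y \<in> L"
  using VV_U U_mult_VV by (simp add: L_def mult_commute[of "x \<star> y"])

lemma L_mult_V:
  assumes x: "x \<in> L" and v: "v \<in> V"
  shows "x \<star> v \<in> L"
proof -
  have "(x \<star> v) \<star> u = 0" if u: "u \<in> U" for u
  proof -
    have "(x \<star> v) \<star> u = u \<star> (x \<star> v)" by (rule mult_commute)
    also have "\<dots> = - (x \<star> (u \<star> v))" by (rule U_absorb_polarized[OF u L_U[OF x] v])
    also have "\<dots> = 0" using L_mult_U[OF x UV_U[OF u v]] by simp
    finally show ?thesis .
  qed
  then show ?thesis using UV_U[OF L_U[OF x] v] by (simp add: L_def)
qed

lemma ideal_L: "ideal L"
proof -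
  have "ideal (span L)"
    using L_mult_U L_mult_V subspace_0[OF subspace_L] e_mult_homogeneous[OF _ subspace_L] L_U
    by (intro ideal_span) (auto intro!: span_base)
  then show ?thesis using subspace_L by (simp add: span_eq_iff[THEN iffD2])
qed

lemma L_barideal: "L \<subseteq> barideal"
  using L_U U_barideal by blast

lemma UVV_L:
  assumes u: "u \<in> U" and v: "v \<in> V"
  shows "(u \<star> v) \<star> v \<in> L"
proof -
  have "((u \<star> v) \<star> v) \<star> w = 0" if w: "w \<in> U" for w
  proof -
    have "((u \<star> v) \<star> v) \<star> w = w \<star> ((u \<star> v) \<star> v)" by (rule mult_commute)
    also have "\<dots> = - ((u \<star> v) \<star> (w \<star> v))"
      by (rule U_absorb_polarized[OF w UV_U[OF u v] v])
    also have "\<dots> = 0" using UV_square_polarized[OF u w v] by simp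
    finally show ?thesis .
  qed
  moreover have "(u \<star> v) \<star> v \<in> U" using u v by (intro UV_U)
  ultimately show ?thesis by (simp add: L_def)
qed

lemma UVV_L_polarized:
  assumes "u \<in> U" "v \<in> V" "w \<in> V"
  shows "(u \<star> v) \<star> w + (u \<star> w) \<star> v \<in> L"
proof -
  have "v + w \<in> V" using assms subspace_V by (intro subspace_add)
  then have "(u \<star> (v + w)) \<star> (v + w) - (u \<star> v) \<star> v - (u \<star> w) \<star> w \<in> L"
    using assms by (intro subspace_diff[OF subspace_L] UVV_L)
  moreover have "(u \<star> (v + w)) \<star> (v + w) - (u \<star> v) \<star> v - (u \<star> w) \<star> w
      = (u \<star> v) \<star> w + (u \<star> w) \<star> v"
    by (simp add: mult_add_left mult_add_right)
  ultimately show ?thesis by simp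
qed

text \<open>
  The expression is symmetric in \<open>x\<close>, \<open>y\<close> and \<open>z\<close>, so only the number of arguments in \<open>V\<close>
  matters. For none it is the polarized cube of \<open>U\<close>; for one it reduces to an element of
  \<open>V \<star> V\<close>; for two it is the polarization of \<open>(u \<star> v) \<star> v\<close>; for three every term lies in
  \<open>(V \<star> V) \<star> V\<close>.
\<close>

lemma cubic_identity_mod_L:
  assumes "x \<in> barideal" "y \<in> barideal" "z \<in> barideal"
  shows "(x \<star> y) \<star> z + (x \<star> z) \<star> y + x \<star> (y \<star> z) \<in> L"
proof -
  define T where "T x y z = (x \<star> y) \<star> z + (x \<star> z) \<star> y + x \<star> (y \<star> z)" for x y z
  have T_add: "T (x + x') y z = T x y z + T x' y z" for x x' y z
    by (simp add: T_def mult_add_left mult_add_right)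
  have swap12: "T x y z = T y x z" for x y z
    using mult_commute[of y x] mult_commute[of "x \<star> z" y] mult_commute[of "y \<star> z" x]
    by (simp add: T_def add_ac)
  have swap23: "T x y z = T x z y" for x y z
    using mult_commute[of y z] by (simp add: T_def add_ac)
  have zero: "0 \<in> L" using subspace_L by (rule subspace_0)
  have UUU: "T x y z \<in> L" if "x \<in> U" "y \<in> U" "z \<in> U" for x y z
  proof -
    have "T x y z = x \<star> (y \<star> z) + y \<star> (x \<star> z) + z \<star> (x \<star> y)"
      using mult_commute[of "x \<star> y" z] mult_commute[of "x \<star> z" y] by (simp add: T_def add_ac)
    with U_cube_polarized[OF that] zero show ?thesis by simp
  qed
  have UUV: "T x y z \<in> L" if "x \<in> U" "y \<in> U" "z \<in> V" for x y z
  proof -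
    have "T x y z = (x \<star> y) \<star> z"
      using U_absorb_polarized[OF that] mult_commute[of "x \<star> z" y] by (simp add: T_def)
    with that show ?thesis by (simp add: VV_L UU_V)
  qed
  have UVV: "T x y z \<in> L" if "x \<in> U" "y \<in> V" "z \<in> V" for x y z
    using UVV_L_polarized[OF that] U_mult_VV[OF that] by (simp add: T_def)
  have VVV: "T x y z \<in> L" if "x \<in> V" "y \<in> V" "z \<in> V" for x y z
    using that L_mult_V VV_L mult_commute[of x] subspace_L
    unfolding T_def by (metis subspace_add)
  have hom: "T x y z \<in> L" if "x \<in> U \<union> V" "y \<in> U \<union> V" "z \<in> U \<union> V" for x y z
    using that UUU UUV UVV VVV swap12 swap23 by (metis Un_iff)
  have first: "T x y z \<in> L"
    if bx: "x \<in> barideal" and hx: "\<And>h. h \<in> U \<union> V \<Longrightarrow> T h y z \<in> L" for x y z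
  proof -
    obtain v where "e \<star> x + e \<star> x \<in> U" "v \<in> V" and x: "x = (e \<star> x + e \<star> x) + v"
      using peirce_decomposition[OF bx] .
    then have "T (e \<star> x + e \<star> x) y z + T v y z \<in> L"
      by (intro subspace_add[OF subspace_L] hx) auto
    then have "T ((e \<star> x + e \<star> x) + v) y z \<in> L" by (simp only: T_add)
    with x show ?thesis by simp
  qed
  have "T x y z \<in> L" if "x \<in> U \<union> V" "y \<in> U \<union> V" "z \<in> barideal" for x y z
    using first[of z x y] hom that swap12 swap23 by metis
  then have "T x y z \<in> L" if "x \<in> U \<union> V" "y \<in> barideal" "z \<in> barideal" for x y z
    using first[of y x z] that swap12 swap23 by metis
  then have "T x y z \<in> L" using first assms by metis
  then show ?thesis by (simp add: T_def)
qed

section \<open>Long words vanish modulo L\<close>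

lemma word_swap_mod_L:
  assumes "p \<in> barideal" "x \<in> barideal" "y \<in> barideal"
  shows "foldl (\<star>) p (as @ [x, y] @ bs) + foldl (\<star>) p (as @ [y, x] @ bs)
    + foldl (\<star>) p (as @ [x \<star> y] @ bs) \<in> L"
proof -
  define a where "a = foldl (\<star>) p as"
  have "a \<in> barideal" unfolding a_def using assms(1) by (rule foldl_barideal)
  then have "(a \<star> x) \<star> y + (a \<star> y) \<star> x + a \<star> (x \<star> y) \<in> L"
    using assms by (intro cubic_identity_mod_L)
  from foldl_mult_ideal[OF ideal_L this, of bs] show ?thesis
    by (simp add: foldl_mult_add a_def)
qed

text \<open>
  Letters are taken from all monomials in \<open>X\<close> of degree less than \<open>n\<close>, and each carries its degree,
  so that exchanging neighbours costs a shorter word of the same total degree. The induction is on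
  the length of a word whose total degree is large: either a letter has degree at least \<open>n\<close> and is
  0, or some letter occurs twice, since there are only \<open>card T\<close> letters.
\<close>

lemma long_words_mod_L:
  assumes "locally_nilpotent barideal" "finite X" "X \<subseteq> barideal" "p \<in> barideal"
  obtains m where "\<And>xs. set xs \<subseteq> X \<Longrightarrow> m \<le> length xs \<Longrightarrow> foldl (\<star>) p xs \<in> L"
proof -
  obtain n where n: "\<And>k x. monomial X k x \<Longrightarrow> n \<le> k \<Longrightarrow> x = 0"
    using locally_nilpotent_monomials_vanish[OF assms(1-3)] by blast
  define T where "T = (SIGMA k:{..<n}. {x. monomial X k x})"
  define good where "good ws \<longleftrightarrow> (\<forall>(k, x)\<in>set ws. monomial X k x)" for ws :: "(nat \<times> 'a) list"
  define val where "val ws = foldl (\<star>) p (map snd ws)" for ws :: "(nat \<times> 'a) list"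
  define wt where "wt ws = sum_list (map fst ws)" for ws :: "(nat \<times> 'a) list"
  have "finite T"
    unfolding T_def using finite_monomials[OF assms(2)] by (intro finite_SigmaI) auto
  have monomial_barideal: "x \<in> barideal" if "monomial X k x" for k x
    using that by induction (use assms(3) mult_barideal in auto)
  have words: "val ws \<in> L" if "good ws" "card T * n < wt ws" for ws
    using that
  proof (induction "length ws" arbitrary: ws rule: less_induct)
    case less
    show ?case
    proof (cases "\<exists>(k, x)\<in>set ws. n \<le> k")
      case True
      then obtain k x where kx: "(k, x) \<in> set ws" "n \<le> k" by blast
      then have "x = 0" using n less.prems(1) by (auto simp: good_def)
      then have "0 \<in> set (map snd ws)" using kx(1) by force
      then show ?thesis
        using foldl_mult_zero_mem subspace_0[OF subspace_L] by (simp add: val_def)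
    next
      case False
      then have subT: "set ws \<subseteq> T" using less.prems(1) by (auto simp: T_def good_def)
      have "\<not> distinct ws"
      proof
        assume "distinct ws"
        then have "length ws \<le> card T"
          using card_mono[OF \<open>finite T\<close> subT] by (simp add: distinct_card)
        moreover have "wt ws \<le> length ws * n"
        proof -
          have "(\<forall>k\<in>set ks. k \<le> n) \<Longrightarrow> sum_list ks \<le> length ks * n" for ks :: "nat list"
            by (induction ks) auto
          moreover have "\<forall>k\<in>set (map fst ws). k \<le> n" using subT by (auto simp: T_def)
          ultimately show ?thesis unfolding wt_def by (metis length_map)
        qed
        ultimately have "wt ws \<le> card T * n"
          using mult_le_mono1 order.trans by blast
        with less.prems(2) show False by simp
      qed
      then obtain as bs cs t where ws: "ws = as @ [t] @ bs @ [t] @ cs"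
        using not_distinct_decomp by blast
      have swap: "val (us @ [s, t] @ vs) + val (us @ [t, s] @ vs) \<in> L"
        if w: "good (us @ [s, t] @ vs)" "wt (us @ [s, t] @ vs) = wt ws"
          "length (us @ [s, t] @ vs) = length ws" for us s t vs
      proof -
        obtain i x where s: "s = (i, x)" by fastforce
        obtain j y where t: "t = (j, y)" by fastforce
        have mon: "monomial X i x" "monomial X j y" using w(1) by (auto simp: good_def s t)
        have "good (us @ [(i + j, x \<star> y)] @ vs)"
          using w(1) monomial.product[OF mon] by (auto simp: good_def)
        moreover have "wt (us @ [(i + j, x \<star> y)] @ vs) = wt ws"
          using w(2) by (simp add: wt_def s t)
        moreover have "length (us @ [(i + j, x \<star> y)] @ vs) < length ws" using w(3) by simp
        ultimately have "val (us @ [(i + j, x \<star> y)] @ vs) \<in> L"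
          using less.hyps less.prems(2) by metis
        moreover have "val (us @ [s, t] @ vs) + val (us @ [t, s] @ vs)
            + val (us @ [(i + j, x \<star> y)] @ vs) \<in> L"
          using word_swap_mod_L[OF assms(4) monomial_barideal[OF mon(1)]
              monomial_barideal[OF mon(2)], of "map snd us" "map snd vs"]
          by (simp add: val_def s t)
        ultimately show ?thesis using subspace_diff[OF subspace_L] by fastforce
      qed
      \<comment> \<open>Move the first \<open>t\<close> next to the second one, changing the sign of the value at each step.
        Twice the value of a word with \<open>t\<close> followed by \<open>t\<close> is that of a shorter word, modulo \<open>L\<close>
        and up to sign.\<close>
      have "val (us @ [t] @ bs @ [t] @ cs) \<in> L"
        if "good (us @ [t] @ bs @ [t] @ cs)" "wt (us @ [t] @ bs @ [t] @ cs) = wt ws"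
          "length (us @ [t] @ bs @ [t] @ cs) = length ws" for us bs
        using that
      proof (induction bs arbitrary: us)
        case Nil
        then have "val (us @ [t, t] @ cs) + val (us @ [t, t] @ cs) \<in> L"
          by (intro swap) auto
        then have "val (us @ [t, t] @ cs) \<in> L" by (rule double_mem[OF subspace_L])
        then show ?case by simp
      next
        case (Cons s bs)
        have "val (us @ [t, s] @ (bs @ [t] @ cs)) + val (us @ [s, t] @ (bs @ [t] @ cs)) \<in> L"
          using Cons.prems by (intro swap) simp_all
        moreover have "val ((us @ [s]) @ [t] @ bs @ [t] @ cs) \<in> L"
        proof (rule Cons.IH)
          show "good ((us @ [s]) @ [t] @ bs @ [t] @ cs)"
            using Cons.prems(1) by (auto simp: good_def)
          show "wt ((us @ [s]) @ [t] @ bs @ [t] @ cs) = wt ws"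
            using Cons.prems(2) by (simp add: wt_def)
          show "length ((us @ [s]) @ [t] @ bs @ [t] @ cs) = length ws"
            using Cons.prems(3) by simp
        qed
        ultimately show ?case using subspace_diff[OF subspace_L] by fastforce
      qed
      then show ?thesis using less.prems(1) ws by blast
    qed
  qed
  show thesis
  proof (rule that[of "Suc (card T * n)"])
    fix xs assume xs: "set xs \<subseteq> X" "Suc (card T * n) \<le> length xs"
    have "good (map (Pair 1) xs)"
      using xs(1) by (auto simp: good_def intro: monomial.generator[simplified])
    moreover have "wt (map (Pair 1) xs) = length xs"
      by (induction xs) (auto simp: wt_def)
    moreover have "val (map (Pair 1) xs) = foldl (\<star>) p xs"
      by (simp add: val_def comp_def)
    ultimately show "foldl (\<star>) p xs \<in> L" using words[of "map (Pair 1) xs"] xs(2) by simp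
  qed
qed

section \<open>A Nakayama lemma\<close>

text \<open>
  The preimage of the product of \<open>P\<close> and the barideal in the quotient by \<open>L\<close>; adding \<open>L\<close> here
  avoids working in a quotient algebra.
\<close>

definition descend :: "'a set \<Rightarrow> 'a set" where
  "descend P = span ({x \<star> y |x y. x \<in> P \<and> y \<in> barideal} \<union> L)"

lemma mult_descend: "x \<in> P \<Longrightarrow> y \<in> barideal \<Longrightarrow> x \<star> y \<in> descend P"
  unfolding descend_def by (intro span_base) blast

lemma L_descend: "L \<subseteq> descend P"
  unfolding descend_def using span_superset by blast

lemma subspace_descend: "subspace (descend P)"
  by (simp add: descend_def)

lemma descend_subset: "ideal P \<Longrightarrow> L \<subseteq> P \<Longrightarrow> descend P \<subseteq> P"
  unfolding descend_def by (intro span_minimal) (auto simp: ideal_def)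

lemma ideal_descend:
  assumes "ideal P" "P \<subseteq> barideal"
  shows "ideal (descend P)"
proof -
  have "e \<star> (x \<star> y) \<in> descend P" if x: "x \<in> P" and y: "y \<in> barideal" for x y
  proof -
    define a where "a = (e \<star> x) \<star> (e \<star> y)"
    have "a \<in> descend P"
      using assms(1) x y unfolding a_def
      by (intro mult_descend) (auto simp: ideal_def barideal_def weight_mult)
    then have "x \<star> y - (a + a + a + a) \<in> descend P"
      using mult_descend[OF x y]
      by (intro subspace_diff[OF subspace_descend] subspace_add[OF subspace_descend])
    moreover have "a + a + a + a + e \<star> (x \<star> y) + e \<star> (x \<star> y) = x \<star> y"
      unfolding a_def using assms(2) x y by (intro peirce_mult) auto
    then have "x \<star> y - (a + a + a + a) = e \<star> (x \<star> y) + e \<star> (x \<star> y)"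
      by (simp add: algebra_simps)
    ultimately have "e \<star> (x \<star> y) + e \<star> (x \<star> y) \<in> descend P" by simp
    then show ?thesis by (rule double_mem[OF subspace_descend])
  qed
  moreover have "(x \<star> y) \<star> z \<in> descend P"
    if "x \<in> P" "y \<in> barideal" "z \<in> U \<union> V" for x y z
  proof (rule mult_descend)
    show "x \<star> y \<in> P" using that(1) assms(1) by (simp add: ideal_def)
    show "z \<in> barideal" using that(3) by (rule homogeneous_barideal)
  qed
  moreover have "e \<star> x \<in> descend P" "x \<star> z \<in> descend P" if "x \<in> L" for x z
    using that ideal_L L_descend by (auto simp: ideal_def)
  ultimately show ?thesis
    unfolding descend_def by (intro ideal_span) auto
qed

text \<open>
  One element replaces the finite generating set of the usual Nakayama lemma: below \<open>P\<close> there is a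
  maximal ideal \<open>Q\<close>, and \<open>P\<close> is generated modulo \<open>Q\<close> by the multiples of a single homogeneous
  \<open>p\<close>. So modulo \<open>Q\<close> it is itself a combination of multiples \<open>p y\<^sub>1 \<dots> y\<^sub>k\<close> with \<open>k \<ge> 1\<close>; substituting this
  for \<open>p\<close> again and again produces, modulo \<open>Q\<close>, words that are too long to lie outside \<open>L\<close>.
\<close>

lemma nakayama:
  assumes noetherian "locally_nilpotent barideal"
    and P: "ideal P" "L \<subseteq> P" "P \<subseteq> barideal" "P \<subseteq> descend P"
  shows "P \<subseteq> L"
proof (rule ccontr)
  assume "\<not> P \<subseteq> L"
  define \<C> where "\<C> = {Q. ideal Q \<and> L \<subseteq> Q \<and> Q \<subset> P}"
  have "L \<in> \<C>" using ideal_L P(2) \<open>\<not> P \<subseteq> L\<close> by (auto simp: \<C>_def)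
  then have "\<C> \<noteq> {}" by blast
  moreover have "ideal I" if "I \<in> \<C>" for I using that by (simp add: \<C>_def)
  ultimately obtain Q where "Q \<in> \<C>" and maximal: "\<And>I. I \<in> \<C> \<Longrightarrow> Q \<subseteq> I \<Longrightarrow> I = Q"
    using noetherian_maximal[OF assms(1), of \<C>] by blast
  then have Q: "ideal Q" "L \<subseteq> Q" "Q \<subset> P" by (auto simp: \<C>_def)
  then have subQ: "subspace Q" by (simp add: ideal_def)
  have "\<exists>p\<in>P \<inter> (U \<union> V). \<exists>y\<in>U \<union> V. p \<star> y \<notin> Q"
  proof (rule ccontr)
    assume "\<not> ?thesis"
    then have hom: "p \<star> y \<in> Q" if "p \<in> P \<inter> (U \<union> V)" "y \<in> U \<union> V" for p y
      using that by blast
    have "p \<star> y \<in> Q" if p: "p \<in> P" and y: "y \<in> barideal" for p y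
    proof (rule mult_barideal_mem[OF y subQ])
      fix z assume z: "z \<in> U \<union> V"
      have "P \<subseteq> {p. p \<star> z \<in> Q}"
      proof (rule ideal_component[OF P(1,3)])
        show "subspace {p. p \<star> z \<in> Q}"
          using subQ by (auto simp: subspace_def mult_add_left mult_scale_left)
      qed (use hom z in auto)
      with p show "p \<star> z \<in> Q" by blast
    qed
    then have "descend P \<subseteq> Q"
      unfolding descend_def using Q(2) subQ by (intro span_minimal) auto
    with P(4) Q(3) show False by blast
  qed
  then obtain p y where p: "p \<in> P" "p \<in> U \<union> V" and y: "y \<in> U \<union> V" and py: "p \<star> y \<notin> Q"
    by blast
  \<comment> \<open>Homogeneous letters make every word homogeneous, so that the span below is stable under \<open>e\<close>.\<close>
  define W where "W = {ys. ys \<noteq> [] \<and> set ys \<subseteq> U \<union> V}"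
  define E where "E = foldl (\<star>) p ` W"
  have "ideal (span (E \<union> Q))"
  proof (rule ideal_span)
    fix g assume g: "g \<in> E \<union> Q"
    show "e \<star> g \<in> span (E \<union> Q)"
    proof (cases "g \<in> Q")
      case True
      then show ?thesis using Q(1) by (intro span_base) (auto simp: ideal_def)
    next
      case False
      then have "g \<in> U \<union> V" using g p(2) homogeneous_foldl by (auto simp: E_def W_def)
      with g show ?thesis by (intro e_mult_homogeneous span_base subspace_span)
    qed
    fix z assume z: "z \<in> U \<union> V"
    show "g \<star> z \<in> span (E \<union> Q)"
    proof (cases "g \<in> Q")
      case True
      then show ?thesis using Q(1) by (intro span_base) (auto simp: ideal_def)
    next
      case False
      then obtain ys where "ys \<in> W" "g = foldl (\<star>) p ys" using g by (auto simp: E_def)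
      then have "g \<star> z = foldl (\<star>) p (ys @ [z])" "ys @ [z] \<in> W" using z by (auto simp: W_def)
      then have "g \<star> z \<in> E" unfolding E_def by (metis imageI)
      then show ?thesis by (intro span_base) simp
    qed
  qed
  moreover have "Q \<subseteq> span (E \<union> Q)" using span_superset by blast
  moreover have "span (E \<union> Q) \<subseteq> P"
    using P(1) p(1) Q(3) foldl_mult_ideal[OF P(1)]
    by (intro span_minimal) (auto simp: E_def ideal_def)
  moreover have "p \<star> y \<in> E"
    unfolding E_def using y by (intro image_eqI[of _ _ "[y]"]) (auto simp: W_def)
  then have "p \<star> y \<in> span (E \<union> Q)" by (intro span_base) simp
  ultimately have "span (E \<union> Q) = P"
    using maximal[of "span (E \<union> Q)"] Q(2) py by (auto simp: \<C>_def)
  then have "p \<in> span (E \<union> Q)" using p(1) by simp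
  then obtain A r where A: "finite A" "A \<subseteq> E \<union> Q" "p = (\<Sum>a\<in>A. r a *s a)"
    unfolding span_explicit by blast
  then have "finite (A \<inter> E)" "A \<inter> E \<subseteq> foldl (\<star>) p ` W" by (auto simp: E_def)
  then obtain C where C: "C \<subseteq> W" "finite C" "A \<inter> E = foldl (\<star>) p ` C"
    using finite_subset_image by metis
  then have "A \<subseteq> foldl (\<star>) p ` C \<union> Q" using A(2) by blast
  then have p_span: "p \<in> span (foldl (\<star>) p ` C \<union> Q)"
    unfolding A(3) by (intro span_sum span_scale span_base) blast
  define X where "X = \<Union> (set ` C)"
  have "finite X" using C(2) by (simp add: X_def)
  moreover have "X \<subseteq> barideal" using C(1) homogeneous_barideal by (auto simp: X_def W_def)
  moreover have "p \<in> barideal" using p(1) P(3) by blast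
  ultimately obtain m where
    m: "\<And>xs. set xs \<subseteq> X \<Longrightarrow> m \<le> length xs \<Longrightarrow> foldl (\<star>) p xs \<in> L"
    using long_words_mod_L[OF assms(2)] by metis
  define T where "T j = span ({foldl (\<star>) p ys |ys. set ys \<subseteq> X \<and> j \<le> length ys} \<union> Q)" for j
  have p_T: "p \<in> T j" for j
  proof (induction j)
    case 0
    have "p = foldl (\<star>) p []" by simp
    then show ?case unfolding T_def by (intro span_base) (auto intro!: exI[of _ "[]"])
  next
    case (Suc j)
    have "foldl (\<star>) p zs \<in> T (Suc j)" if zs: "zs \<in> C" for zs
      using Suc unfolding T_def[of j]
    proof (rule foldl_mult_span)
      show "subspace (T (Suc j))" by (simp add: T_def)
      fix s assume "s \<in> {foldl (\<star>) p ys |ys. set ys \<subseteq> X \<and> j \<le> length ys} \<union> Q"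
      then consider ys where "s = foldl (\<star>) p ys" "set ys \<subseteq> X" "j \<le> length ys" | "s \<in> Q"
        by blast
      then show "foldl (\<star>) s zs \<in> T (Suc j)"
      proof cases
        case 1
        have "set zs \<subseteq> X" using zs by (auto simp: X_def)
        with 1 have "foldl (\<star>) s zs = foldl (\<star>) p (ys @ zs)" "set (ys @ zs) \<subseteq> X" by auto
        moreover have "Suc j \<le> length (ys @ zs)"
          using 1(3) zs C(1) by (cases zs) (auto simp: W_def)
        ultimately show ?thesis unfolding T_def by (intro span_base) blast
      next
        case 2
        then show ?thesis
          unfolding T_def using foldl_mult_ideal[OF Q(1)] by (intro span_base) blast
      qed
    qed
    moreover have "Q \<subseteq> T (Suc j)" unfolding T_def using span_superset by blast
    ultimately have "span (foldl (\<star>) p ` C \<union> Q) \<subseteq> T (Suc j)"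
      by (intro span_minimal) (auto simp: T_def)
    with p_span show ?case by blast
  qed
  have "T m \<subseteq> Q" unfolding T_def using m Q(2) subQ by (intro span_minimal) auto
  then have "p \<in> Q" using p_T by blast
  then have "p \<star> y \<in> Q" using Q(1) by (simp add: ideal_def)
  with py show False by simp
qed

section \<open>The barideal modulo L\<close>

text \<open>
  Modulo \<open>descend barideal\<close> all products in the barideal vanish, so every homogeneous set spans an
  ideal there, and the chain condition bounds the dimension.
\<close>

lemma barideal_finite_mod_descend:
  assumes noetherian
  obtains F where "finite F" "F \<subseteq> barideal" "barideal \<subseteq> span (F \<union> descend barideal)"
proof -
  let ?D = "descend barideal"
  have D: "ideal ?D" by (intro ideal_descend ideal_barideal order.refl)
  define \<C> where "\<C> = {span (F \<union> ?D) |F. finite F \<and> F \<subseteq> U \<union> V}"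
  have ideal_C: "ideal I" if "I \<in> \<C>" for I
  proof -
    from that obtain F where F: "I = span (F \<union> ?D)" "F \<subseteq> U \<union> V" by (auto simp: \<C>_def)
    show ?thesis
      unfolding F(1)
    proof (rule ideal_span)
      fix g assume g: "g \<in> F \<union> ?D"
      show "e \<star> g \<in> span (F \<union> ?D)"
      proof (cases "g \<in> ?D")
        case True
        then show ?thesis using D by (intro span_base) (auto simp: ideal_def)
      next
        case False
        then have "g \<in> U \<union> V" using g F(2) by blast
        with g show ?thesis by (intro e_mult_homogeneous span_base subspace_span)
      qed
      fix z assume z: "z \<in> U \<union> V"
      have "g \<in> barideal"
        using g F(2) homogeneous_barideal
          descend_subset[OF ideal_barideal L_barideal] by blast
      then have "g \<star> z \<in> ?D" using homogeneous_barideal[OF z] by (rule mult_descend)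
      then show "g \<star> z \<in> span (F \<union> ?D)" by (intro span_base) simp
    qed
  qed
  have "span ({} \<union> ?D) \<in> \<C>" unfolding \<C>_def by blast
  then have "\<C> \<noteq> {}" by blast
  with ideal_C obtain M where "M \<in> \<C>" and maximal: "\<And>I. I \<in> \<C> \<Longrightarrow> M \<subseteq> I \<Longrightarrow> I = M"
    using noetherian_maximal[OF assms, of \<C>] by blast
  then obtain F where F: "M = span (F \<union> ?D)" "finite F" "F \<subseteq> U \<union> V" by (auto simp: \<C>_def)
  have "x \<in> M" if x: "x \<in> U \<union> V" for x
  proof -
    have "span (insert x F \<union> ?D) \<in> \<C>" unfolding \<C>_def using F(2,3) x by blast
    moreover have "M \<subseteq> span (insert x F \<union> ?D)" unfolding F(1) by (intro span_mono) auto
    ultimately have "span (insert x F \<union> ?D) = M" by (rule maximal)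
    then show ?thesis using span_base[of x "insert x F \<union> ?D"] by simp
  qed
  then have "barideal \<subseteq> M"
    by (intro ideal_component[OF ideal_barideal order.refl]) (auto simp: F(1))
  moreover have "F \<subseteq> barideal" using F(3) homogeneous_barideal by blast
  ultimately show thesis using that F(1,2) by blast
qed

text \<open>
  The index counts the multiplications: \<open>words F k\<close> has \<open>k + 1\<close> letters, so that its elements lie
  in the layer with the same index.
\<close>

definition words :: "'a set \<Rightarrow> nat \<Rightarrow> 'a set" where
  "words F k = {foldl (\<star>) f fs |f fs. f \<in> F \<and> set fs \<subseteq> F \<and> length fs = k}"

lemma finite_words: "finite F \<Longrightarrow> finite (words F k)"
proof -
  assume F: "finite F"
  have "words F k = (\<lambda>(f, fs). foldl (\<star>) f fs) ` (F \<times> {fs. set fs \<subseteq> F \<and> length fs = k})"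
    by (auto simp: words_def)
  then show ?thesis using F by (simp add: finite_lists_length_eq)
qed

lemma words_mult: "w \<in> words F k \<Longrightarrow> f \<in> F \<Longrightarrow> w \<star> f \<in> words F (Suc k)"
proof -
  assume "w \<in> words F k" "f \<in> F"
  then obtain g gs where "w = foldl (\<star>) g gs" "g \<in> F" "set gs \<subseteq> F" "length gs = k"
    by (auto simp: words_def)
  with \<open>f \<in> F\<close> have "w \<star> f = foldl (\<star>) g (gs @ [f])" "set (gs @ [f]) \<subseteq> F"
    "length (gs @ [f]) = Suc k" by auto
  with \<open>g \<in> F\<close> show ?thesis unfolding words_def by blast
qed

abbreviation layer :: "nat \<Rightarrow> 'a set" where
  "layer k \<equiv> (descend ^^ k) barideal"

lemma layer_ideal: "ideal (layer k) \<and> L \<subseteq> layer k \<and> layer k \<subseteq> barideal"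
proof (induction k)
  case 0
  then show ?case using ideal_barideal L_barideal by simp
next
  case (Suc k)
  then have "descend (layer k) \<subseteq> barideal" using descend_subset by blast
  then show ?case using Suc ideal_descend L_descend by simp
qed

lemma words_layer:
  assumes "F \<subseteq> barideal"
  shows "words F k \<subseteq> layer k"
proof (induction k)
  case 0
  then show ?case using assms by (auto simp: words_def)
next
  case (Suc k)
  show ?case
  proof
    fix w assume "w \<in> words F (Suc k)"
    then obtain f fs where w: "w = foldl (\<star>) f fs" "f \<in> F" "set fs \<subseteq> F" "length fs = Suc k"
      by (auto simp: words_def)
    then obtain gs g where fs: "fs = gs @ [g]" by (cases fs rule: rev_cases) auto
    with w have "foldl (\<star>) f gs \<in> words F k" by (auto simp: words_def)
    then have "foldl (\<star>) f gs \<in> layer k" using Suc by blast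
    moreover have "g \<in> barideal" using w(3) fs assms by auto
    ultimately have "foldl (\<star>) f gs \<star> g \<in> descend (layer k)" by (rule mult_descend)
    then show "w \<in> layer (Suc k)" by (simp add: w(1) fs)
  qed
qed

text \<open>
  Left-normed words in \<open>F\<close> suffice because modulo \<open>L\<close> a product \<open>w \<star> (a \<star> b)\<close> is
  \<open>- (w \<star> a) \<star> b - (w \<star> b) \<star> a\<close>, which lies two layers below \<open>w\<close> and not just one.
\<close>

lemma layer_words:
  assumes F: "F \<subseteq> barideal" "barideal \<subseteq> span (F \<union> descend barideal)"
  shows "layer k \<subseteq> span (words F k \<union> layer (Suc k))"
proof (induction k)
  case 0
  have "words F 0 = F" by (auto simp: words_def)
  then show ?case using F(2) by simp
next
  case (Suc k)
  let ?W = "span (words F (Suc k) \<union> layer (Suc (Suc k)))"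
  have low: "z \<in> ?W" if "z \<in> layer (Suc (Suc k))" for z
    using that by (intro span_base) simp
  have step: "z \<star> b \<in> layer (Suc (Suc k))" if "z \<in> layer (Suc k)" "b \<in> barideal" for z b
    using that mult_descend[of z "layer (Suc k)" b] by simp
  have down: "z \<star> b \<in> layer (Suc k)" if "z \<in> layer k" "b \<in> barideal" for z b
    using that mult_descend[of z "layer k" b] by simp
  have sub: "subspace (layer (Suc (Suc k)))" using layer_ideal ideal_def by blast
  have word: "w \<star> y \<in> ?W" if w: "w \<in> words F k" and y: "y \<in> barideal" for w y
  proof (rule mult_span_right[of y "F \<union> descend barideal"])
    show "y \<in> span (F \<union> descend barideal)" using y F(2) by blast
    have wk: "w \<in> layer k" using w words_layer[OF F(1)] by blast
    then have wb: "w \<in> barideal" using layer_ideal by blast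
    fix s assume "s \<in> F \<union> descend barideal"
    then show "w \<star> s \<in> ?W"
    proof
      assume "s \<in> F"
      then show ?thesis using words_mult[OF w] by (intro span_base) simp
    next
      assume "s \<in> descend barideal"
      then have "s \<in> span ({x \<star> y |x y. x \<in> barideal \<and> y \<in> barideal} \<union> L)"
        by (simp only: descend_def)
      then have "w \<star> s \<in> layer (Suc (Suc k))"
      proof (rule mult_span_right[OF _ sub])
        fix t assume "t \<in> {x \<star> y |x y. x \<in> barideal \<and> y \<in> barideal} \<union> L"
        then consider a b where "t = a \<star> b" "a \<in> barideal" "b \<in> barideal" | "t \<in> L" by blast
        then show "w \<star> t \<in> layer (Suc (Suc k))"
        proof cases
          case 1
          have "(w \<star> a) \<star> b + (w \<star> b) \<star> a + w \<star> (a \<star> b) \<in> layer (Suc (Suc k))"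
            using cubic_identity_mod_L[OF wb 1(2,3)] layer_ideal by blast
          moreover have "(w \<star> a) \<star> b + (w \<star> b) \<star> a \<in> layer (Suc (Suc k))"
            using 1(2,3) wk by (intro subspace_add[OF sub] step down)
          ultimately have "(w \<star> a) \<star> b + (w \<star> b) \<star> a + w \<star> (a \<star> b)
              - ((w \<star> a) \<star> b + (w \<star> b) \<star> a) \<in> layer (Suc (Suc k))"
            by (rule subspace_diff[OF sub])
          then show ?thesis by (simp only: 1(1) add_diff_cancel_left')
        next
          case 2
          then have "w \<star> t \<in> L" using ideal_L by (simp add: ideal_def)
          then show ?thesis using layer_ideal by blast
        qed
      qed
      then show ?thesis by (rule low)
    qed
  qed simp
  have "x \<star> y \<in> ?W" if x: "x \<in> layer k" and y: "y \<in> barideal" for x y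
  proof (rule mult_span_left[of x "words F k \<union> layer (Suc k)"])
    show "x \<in> span (words F k \<union> layer (Suc k))" using Suc x by blast
    fix s assume "s \<in> words F k \<union> layer (Suc k)"
    then show "s \<star> y \<in> ?W" using word[OF _ y] low step[OF _ y] by blast
  qed simp
  moreover have "L \<subseteq> ?W" using layer_ideal low by blast
  ultimately have "descend (layer k) \<subseteq> ?W"
    unfolding descend_def by (intro span_minimal) auto
  then show ?case by simp
qed

lemma barideal_finite_mod_L:
  assumes noetherian "locally_nilpotent barideal"
  obtains S where "finite S" "S \<subseteq> barideal" "barideal \<subseteq> span (S \<union> L)"
proof -
  obtain F where F: "finite F" "F \<subseteq> barideal" "barideal \<subseteq> span (F \<union> descend barideal)"
    using barideal_finite_mod_descend[OF assms(1)] by blast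
  obtain n where n: "\<And>k x. monomial F k x \<Longrightarrow> n \<le> k \<Longrightarrow> x = 0"
    using locally_nilpotent_monomials_vanish[OF assms(2) F(1,2)] by blast
  have "words F n \<subseteq> {0}"
  proof
    fix w assume "w \<in> words F n"
    then obtain f fs where "w = foldl (\<star>) f fs" "f \<in> F" "set fs \<subseteq> F" "length fs = n"
      by (auto simp: words_def)
    then have "monomial F (1 + n) w"
      using monomial_foldl[OF monomial.generator] by blast
    then show "w \<in> {0}" using n by simp
  qed
  then have "words F n \<union> layer (Suc n) \<subseteq> layer (Suc n)"
    using layer_ideal[of "Suc n"] subspace_0 ideal_def by blast
  then have "span (words F n \<union> layer (Suc n)) \<subseteq> layer (Suc n)"
    using layer_ideal ideal_def by (intro span_minimal) blast+
  then have "layer n \<subseteq> descend (layer n)" using layer_words[OF F(2,3), of n] by simp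
  then have "layer n \<subseteq> L" using assms layer_ideal by (intro nakayama) auto
  have span_layers: "barideal \<subseteq> span ((\<Union>j<k. words F j) \<union> layer k)" for k
  proof (induction k)
    case 0
    then show ?case using span_superset by simp
  next
    case (Suc k)
    let ?W = "span ((\<Union>j<Suc k. words F j) \<union> layer (Suc k))"
    have "span (words F k \<union> layer (Suc k)) \<subseteq> ?W" by (intro span_mono) auto
    then have "layer k \<subseteq> ?W" using layer_words[OF F(2,3), of k] by blast
    moreover have "(\<Union>j<k. words F j) \<subseteq> ?W" by (auto intro!: span_base simp: less_Suc_eq)
    ultimately have "span ((\<Union>j<k. words F j) \<union> layer k) \<subseteq> ?W"
      by (intro span_minimal) auto
    with Suc show ?case by blast
  qed
  show thesis
  proof (rule that)
    show "finite (\<Union>j<n. words F j)" using finite_words[OF F(1)] by simp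
    show "(\<Union>j<n. words F j) \<subseteq> barideal"
      using words_layer[OF F(2)] layer_ideal by blast
    have "span ((\<Union>j<n. words F j) \<union> layer n) \<subseteq> span ((\<Union>j<n. words F j) \<union> L)"
      using \<open>layer n \<subseteq> L\<close> by (intro span_mono) auto
    with span_layers[of n] show "barideal \<subseteq> span ((\<Union>j<n. words F j) \<union> L)" by blast
  qed
qed

section \<open>Finite dimension\<close>

text \<open>
  Since \<open>L \<star> L = 0\<close>, the barideal acts on \<open>L\<close> through the finite set \<open>S\<close>, and \<open>e\<close> acts as a
  scalar. So the words that start in \<open>G \<subseteq> L\<close> and continue in \<open>S\<close> span an ideal, and for a
  suitable finite \<open>G\<close> this ideal is \<open>L\<close>.
\<close>

lemma L_finite:
  assumes noetherian "locally_nilpotent barideal"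
    and S: "finite S" "S \<subseteq> barideal" "barideal \<subseteq> span (S \<union> L)"
  obtains G where "finite G" "L \<subseteq> span G"
proof -
  define W where "W G = {foldl (\<star>) g ys |g ys. g \<in> G \<and> set ys \<subseteq> S}" for G
  define \<C> where "\<C> = {span (W G) |G. finite G \<and> G \<subseteq> L}"
  have W_L: "W G \<subseteq> L" if "G \<subseteq> L" for G
    using that foldl_mult_ideal[OF ideal_L] by (auto simp: W_def)
  have "ideal I" if "I \<in> \<C>" for I
  proof -
    from that obtain G where G: "I = span (W G)" "G \<subseteq> L" by (auto simp: \<C>_def)
    show ?thesis
      unfolding G(1)
    proof (rule ideal_span)
      fix w assume w: "w \<in> W G"
      then have wL: "w \<in> L" using W_L[OF G(2)] by blast
      then have "w \<in> U \<union> V" using L_U by blast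
      with w show "e \<star> w \<in> span (W G)" by (intro e_mult_homogeneous span_base subspace_span)
      fix z assume "z \<in> U \<union> V"
      then have "z \<in> span (S \<union> L)" using homogeneous_barideal S(3) by blast
      then show "w \<star> z \<in> span (W G)"
      proof (rule mult_span_right[OF _ subspace_span])
        fix s assume "s \<in> S \<union> L"
        then show "w \<star> s \<in> span (W G)"
        proof
          assume s: "s \<in> S"
          from w obtain g ys where "w = foldl (\<star>) g ys" "g \<in> G" "set ys \<subseteq> S"
            by (auto simp: W_def)
          with s have "w \<star> s = foldl (\<star>) g (ys @ [s])" "g \<in> G" "set (ys @ [s]) \<subseteq> S" by auto
          then have "w \<star> s \<in> W G" unfolding W_def by blast
          then show ?thesis by (rule span_base)
        next
          assume "s \<in> L"
          then have "w \<star> s = 0" using wL L_mult_U L_U by blast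
          then show ?thesis by (simp add: span_zero)
        qed
      qed
    qed
  qed
  moreover have "span (W {}) \<in> \<C>" unfolding \<C>_def by blast
  then have "\<C> \<noteq> {}" by blast
  ultimately obtain M where "M \<in> \<C>" and maximal: "\<And>I. I \<in> \<C> \<Longrightarrow> M \<subseteq> I \<Longrightarrow> I = M"
    using noetherian_maximal[OF assms(1), of \<C>] by blast
  then obtain G where G: "M = span (W G)" "finite G" "G \<subseteq> L" by (auto simp: \<C>_def)
  have L_M: "L \<subseteq> M"
  proof
    fix x assume x: "x \<in> L"
    have "span (W (insert x G)) \<in> \<C>" unfolding \<C>_def using G(2,3) x by blast
    moreover have "M \<subseteq> span (W (insert x G))"
      unfolding G(1) by (intro span_mono) (auto simp: W_def)
    ultimately have "span (W (insert x G)) = M" by (rule maximal)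
    moreover have "x = foldl (\<star>) x []" by simp
    then have "x \<in> W (insert x G)" unfolding W_def by fastforce
    ultimately show "x \<in> M" using span_base by blast
  qed
  have "G \<union> S \<subseteq> barideal" using G(3) L_barideal S(2) by blast
  then obtain n where n: "\<And>k x. monomial (G \<union> S) k x \<Longrightarrow> n \<le> k \<Longrightarrow> x = 0"
    using locally_nilpotent_monomials_vanish[OF assms(2), of "G \<union> S"] G(2) S(1) by blast
  define B where
    "B = (\<lambda>(g, ys). foldl (\<star>) g ys) ` (G \<times> {ys. set ys \<subseteq> S \<and> length ys \<le> n})"
  have "finite B"
    unfolding B_def using G(2) S(1) by (simp add: finite_lists_length_le)
  moreover have "W G \<subseteq> span B"
  proof
    fix w assume "w \<in> W G"
    then obtain g ys where w: "w = foldl (\<star>) g ys" "g \<in> G" "set ys \<subseteq> S" by (auto simp: W_def)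
    show "w \<in> span B"
    proof (cases "length ys \<le> n")
      case True
      then have "w \<in> B" unfolding B_def using w by force
      then show ?thesis by (rule span_base)
    next
      case False
      have "monomial (G \<union> S) (1 + length ys) w"
        unfolding w(1) using w(2,3) by (intro monomial_foldl monomial.generator) auto
      then have "w = 0" using n False by simp
      then show ?thesis by (simp add: span_zero)
    qed
  qed
  then have "L \<subseteq> span B" using L_M G(1) span_minimal[of "W G" "span B"] by auto
  ultimately show thesis by (rule that)
qed

lemma finite_spanning_set:
  assumes noetherian "locally_nilpotent barideal"
  obtains B where "finite B" "span B = UNIV"
proof -
  obtain S where S: "finite S" "S \<subseteq> barideal" "barideal \<subseteq> span (S \<union> L)"
    using barideal_finite_mod_L[OF assms] .
  obtain G where G: "finite G" "L \<subseteq> span G"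
    using L_finite[OF assms S] .
  let ?B = "insert e (S \<union> G)"
  have "L \<subseteq> span ?B" using G(2) span_mono[of G ?B] by blast
  moreover have "S \<subseteq> span ?B" using span_superset[of ?B] by blast
  ultimately have "span (S \<union> L) \<subseteq> span ?B"
    by (intro span_minimal[OF Un_least subspace_span])
  then have bar: "barideal \<subseteq> span ?B" using S(3) by blast
  have "x \<in> span ?B" for x
  proof -
    define y where "y = x - \<omega> x *s e"
    have "\<omega> y = 0" using weight_add[of y "\<omega> x *s e"] by (simp add: y_def weight_scale weight_e)
    then have "y \<in> span ?B" using bar by (auto simp: barideal_def)
    moreover have "\<omega> x *s e \<in> span ?B" by (intro span_scale span_base) simp
    ultimately have "y + \<omega> x *s e \<in> span ?B" by (rule span_add)
    then show ?thesis by (simp add: y_def)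
  qed
  moreover have "finite ?B" using S(1) G(1) by simp
  ultimately show thesis using that by blast
qed

end

text \<open>
  If \<open>y\<close> has weight 1, then the Bernstein identity says that \<open>y \<star> y\<close> is an idempotent, and it
  has weight 1 as well.
\<close>

theorem corollary4p8:
  fixes scale :: "'k::field \<Rightarrow> 'a::ab_group_add \<Rightarrow> 'a"
    and mult :: "'a \<Rightarrow> 'a \<Rightarrow> 'a"
    and \<omega> :: "'a \<Rightarrow> 'k"
  assumes "infinite (UNIV :: 'k set)"
    and "CHAR('k) \<noteq> 2" and "CHAR('k) \<noteq> 3"
    and "bernstein_algebra scale mult \<omega>"
    and "nonassoc_algebra.locally_nilpotent scale mult (baric_algebra.barideal \<omega>)"
    and "nonassoc_algebra.noetherian scale mult"
  shows "\<exists>Basis. finite_dimensional_vector_space scale Basis"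
proof -
  interpret bernstein_algebra scale mult \<omega> by (rule assms(4))
  have nonzero: "of_nat p \<noteq> (0::'k)" if "p = 2 \<or> p = 3" "CHAR('k) \<noteq> p" for p :: nat
  proof
    assume "of_nat p = (0::'k)"
    then have d: "CHAR('k) dvd p" by (simp add: of_nat_eq_0_iff_char_dvd)
    then have "CHAR('k) \<le> 3" using dvd_imp_le[OF d] that by auto
    then have "CHAR('k) = 0 \<or> CHAR('k) = 1 \<or> CHAR('k) = 2 \<or> CHAR('k) = 3" by linarith
    moreover have "CHAR('k) \<noteq> 1" using of_nat_CHAR[where ?'a = 'k] by (metis of_nat_1 zero_neq_one)
    moreover have "\<not> 2 dvd (3::nat)" by simp
    ultimately show False using d that by auto
  qed
  obtain x where x: "\<omega> x \<noteq> 0" using weight_nonzero by blast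
  interpret w: Vector_Spaces.linear scale "(*)" \<omega> by (rule weight_linear)
  define y where "y = scale (inverse (\<omega> x)) x"
  have y: "\<omega> y = 1" using x by (simp add: y_def w.scale)
  interpret bernstein_idempotent scale mult \<omega> "mult y y"
  proof
    show "mult (mult y y) (mult y y) = mult y y" using bernstein[of y] y by simp
    show "\<omega> (mult y y) = 1" using y by (simp add: weight_mult)
    show "(2::'k) \<noteq> 0" using nonzero[of 2] assms(2) by simp
    show "(3::'k) \<noteq> 0" using nonzero[of 3] assms(3) by simp
  qed
  obtain S where S: "finite S" "span S = UNIV"
    using finite_spanning_set[OF assms(6,5)] .
  obtain B where B: "B \<subseteq> S" "independent B" "S \<subseteq> span B"
    using maximal_independent_subset[of S] by blast
  have "span B = UNIV" using span_minimal[OF B(3) subspace_span] S(2) by auto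
  moreover have "finite B" using B(1) S(1) by (rule finite_subset)
  ultimately have "finite_dimensional_vector_space scale B"
    using B(2) by unfold_locales
  then show ?thesis by blast
qed

end
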